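(* For each degree $d$ let $N=N(d)\ge 2$ and $m=m(d)\ge 1$ be integers and $\alpha=\alpha(d)\in[0,1]$, and let $A_{m,N,d}$ be the event, in the random solution graph model with parameters $m,N,d,\alpha$ (defined in the context), that the algorithm starting at a random node terminates with $d$ solutions. Then, as $d\to\infty$: (i) If $\alpha(d)=o\bigl((Nm)^{-1}\bigr)$ and $N(d)=o(\exp(d))$, then $\lim_{d\to\infty}\Pr(A_{m,N,d})=0$. (ii) If $\alpha(d)=\omega\bigl(\log d/m\bigr)$ and $N(d)=O(\log d)$, then $\lim_{d\to\infty}\Pr(A_{m,N,d})=1$.
   Context: Random solution graph model with parameters $m,N,d,\alpha$: take the complete multigraph on $N$ nodes with $m$ parallel edges connecting each pair of distinct nodes (the homotopy graph), and attach to each node a set of $d$ solutions. Independently for every edge $e$ joining nodes $v\neq w$, choose a uniformly random bijection between the solutions at $v$ and the solutions at $w$; its $d$ matched pairs are the correspondences of $e$. Each correspondence is successful with probability $\alpha$, all successes being mutually independent and independent of the bijections. The solution (multi)graph has as vertices all $Nd$ solutions at all nodes, and as edges all the successful correspondences (so at most $\binom N2 md$ edges). The algorithm starts from one known solution at a random node and repeatedly tracks known solutions along edges of the homotopy graph, discovering a new solution whenever a successful correspondence joins it to a known one; it terminates with $d$ solutions if at some node all $d$ solutions become known. Thus $A_{m,N,d}$ is the event that the connected component, in the solution graph, of the (randomly chosen) starting solution contains all $d$ solutions of at least one node. For functions of $d$ as $d\to\infty$: $f=o(g)$ means $f/g\to0$, $f=\omega(g)$ means $f/g\to\infty$, and $f=O(g)$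 means $f/g$ is bounded for large $d$. *)

theory Defs
  imports
    "HOL-Probability.Probability"
    "HOL-Library.Landau_Symbols"
    "Graph_Theory.Graph_Theory"
begin

text \<open>
  The nodes are \<open>0, \<dots>, N - 1\<close>; the solution \<open>(v, i)\<close> is the \<open>i\<close>-th of the \<open>d\<close> solutions at node \<open>v\<close>.
  The homotopy edge \<open>(v, w, k)\<close>, with \<open>v < w\<close> so that every undirected edge is listed once, is the
  \<open>k\<close>-th of the \<open>m\<close> parallel edges joining \<open>v\<close> and \<open>w\<close>.  The correspondence \<open>(e, i)\<close> is the matched
  pair of the edge \<open>e = (v, w, k)\<close> that contains the solution \<open>(v, i)\<close>.
\<close>

type_synonym solution = "nat \<times> nat"
type_synonym homotopy_edge = "nat \<times> nat \<times> nat"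
type_synonym correspondence = "homotopy_edge \<times> nat"

text \<open>
  An outcome assigns to each homotopy edge its bijection, read as a permutation of the indices
  \<open>0, \<dots>, d - 1\<close>, and the predicate telling which of its correspondences are successful.
\<close>

type_synonym outcome = "homotopy_edge \<Rightarrow> (nat \<Rightarrow> nat) \<times> (nat \<Rightarrow> bool)"

definition homotopy_edges :: "nat \<Rightarrow> nat \<Rightarrow> homotopy_edge set" where
  "homotopy_edges m N = {(v, w, k). v < w \<and> w < N \<and> k < m}"

definition solutions :: "nat \<Rightarrow> nat \<Rightarrow> solution set" where
  "solutions N d = {..<N} \<times> {..<d}"

definition edge_pmf :: "nat \<Rightarrow> real \<Rightarrow> ((nat \<Rightarrow> nat) \<times> (nat \<Rightarrow> bool)) pmf" where
  "edge_pmf d \<alpha> =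
     pair_pmf (pmf_of_set {\<pi>. \<pi> permutes {..<d}})
              (Pi_pmf {..<d} False (\<lambda>_. bernoulli_pmf \<alpha>))"

definition outcome_pmf :: "nat \<Rightarrow> nat \<Rightarrow> nat \<Rightarrow> real \<Rightarrow> outcome pmf" where
  "outcome_pmf m N d \<alpha> =
     Pi_pmf (homotopy_edges m N) (id, \<lambda>_. False) (\<lambda>_. edge_pmf d \<alpha>)"

text \<open>
  The library provides directed multigraphs.  The solution graph is undirected: the orientation
  of its arcs is an artefact, and connectivity is taken in the symmetrised graph.
\<close>

definition solution_graph ::
  "nat \<Rightarrow> nat \<Rightarrow> nat \<Rightarrow> outcome \<Rightarrow> (solution, correspondence) pre_digraph" where
  "solution_graph m N d \<omega> =
     \<lparr> verts = solutions N d,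
       arcs = {(e, i). e \<in> homotopy_edges m N \<and> i < d \<and> snd (\<omega> e) i},
       tail = (\<lambda>((v, w, k), i). (v, i)),
       head = (\<lambda>((v, w, k), i). (w, fst (\<omega> (v, w, k)) i)) \<rparr>"

definition component_of :: "('a, 'b) pre_digraph \<Rightarrow> 'a \<Rightarrow> 'a set" where
  "component_of G s = {t. s \<rightarrow>\<^sup>*\<^bsub>mk_symmetric G\<^esub> t}"

text \<open>The starting solution is uniformly distributed and independent of the solution graph.\<close>

definition model_pmf :: "nat \<Rightarrow> nat \<Rightarrow> nat \<Rightarrow> real \<Rightarrow> (solution \<times> outcome) pmf" where
  "model_pmf m N d \<alpha> = pair_pmf (pmf_of_set (solutions N d)) (outcome_pmf m N d \<alpha>)"

definition finds_all_solutions :: "nat \<Rightarrow> nat \<Rightarrow> nat \<Rightarrow> (solution \<times> outcome) set" where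
  "finds_all_solutions m N d =
     {(s, \<omega>). \<exists>v<N. \<forall>i<d. (v, i) \<in> component_of (solution_graph m N d \<omega>) s}"

end

theory Submission
  imports Defs "HOL-Real_Asymp.Real_Asymp"
begin

text \<open>
  (i) Fix the bijections.  The solution graph then arises from a fixed multigraph of maximal degree
  at most \<open>N m\<close> by keeping every arc independently with probability \<open>\<alpha>\<close>.  Every solution found is
  the end of a trail of kept arcs, and there are at most \<open>(N m)\<^sup>l\<close> trails of length \<open>l\<close> from the
  start, so the expected number of solutions found is at most \<open>1 / (1 - \<alpha> N m)\<close>.  Success needs \<open>d\<close>
  of them; Markov's inequality gives a bound of order \<open>1 / d\<close>.

  (ii) Only the \<open>m\<close> homotopy edges between two nodes \<open>p\<close> and \<open>q\<close>, one of them the start node, are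
  needed.  If both nodes remain incomplete, and \<open>S\<close> and \<open>T\<close> are the sets of solutions known at \<open>p\<close>
  and \<open>q\<close>, then no successful correspondence joins \<open>S\<close> to the complement of \<open>T\<close>, nor the complement
  of \<open>S\<close> to \<open>T\<close>.  One of these two pairs of sets consists of nonempty sets with at least \<open>d\<close>
  elements in total.  A given pair of sizes \<open>a\<close> and \<open>r\<close> is separated by all \<open>m\<close> edges with
  probability at most \<open>exp (- \<alpha> m a r / d)\<close>, and a union bound over all such pairs suffices once
  \<open>\<alpha> m \<ge> 8 ln d\<close>.
\<close>

section \<open>Probability mass functions\<close>

text \<open>Law of total probability: the probability of an event in a two-stage experiment is the
  mean of its conditional probabilities, which only need to be bounded on the support of the first
  stage.\<close>

lemma prob_bind_pmf_le_expectation: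
  assumes "integrable (measure_pmf p) g"
    and "\<And>x. x \<in> set_pmf p \<Longrightarrow> measure_pmf.prob (q x) A \<le> g x"
  shows "measure_pmf.prob (bind_pmf p q) A \<le> measure_pmf.expectation p g"
proof -
  have nonneg: "AE x in measure_pmf p. 0 \<le> g x"
    using assms(2) by (auto intro!: AE_pmfI intro: order_trans[OF measure_nonneg])
  have "ennreal (measure_pmf.prob (bind_pmf p q) A) = (\<integral>\<^sup>+x. emeasure (q x) A \<partial>p)"
    by (simp flip: measure_pmf.emeasure_eq_measure)
  also have "\<dots> \<le> (\<integral>\<^sup>+x. ennreal (g x) \<partial>p)"
    using assms(2)
    by (intro nn_integral_mono_AE AE_pmfI) (auto simp: measure_pmf.emeasure_eq_measure ennreal_leI)
  also have "\<dots> = ennreal (measure_pmf.expectation p g)"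
    by (rule nn_integral_eq_integral[OF assms(1) nonneg])
  finally show ?thesis
    using integral_nonneg_AE[OF nonneg] by (simp add: ennreal_le_iff)
qed

lemma prob_bind_pmf_le:
  assumes "\<And>x. x \<in> set_pmf p \<Longrightarrow> measure_pmf.prob (q x) A \<le> B"
  shows "measure_pmf.prob (bind_pmf p q) A \<le> B"
  using prob_bind_pmf_le_expectation[of p "\<lambda>_. B" q A] assms by simp

lemma prob_pair_pmf_le:
  assumes "\<And>x. x \<in> set_pmf p \<Longrightarrow> measure_pmf.prob q {y. (x, y) \<in> A} \<le> B"
  shows "measure_pmf.prob (pair_pmf p q) A \<le> B"
proof -
  have eq: "pair_pmf p q = bind_pmf p (\<lambda>x. map_pmf (Pair x) q)"
    by (simp add: pair_pmf_def map_pmf_def)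
  show ?thesis
    unfolding eq using assms by (intro prob_bind_pmf_le) (simp add: vimage_def)
qed

lemma prob_Un_pmf_le:
  assumes "finite I" "\<And>i. i \<in> I \<Longrightarrow> measure_pmf.prob p (A i) \<le> b i"
  shows "measure_pmf.prob p (\<Union>i\<in>I. A i) \<le> (\<Sum>i\<in>I. b i)"
proof -
  have "measure_pmf.prob p (\<Union>i\<in>I. A i) \<le> (\<Sum>i\<in>I. measure_pmf.prob p (A i))"
    using assms(1) by (intro measure_pmf.finite_measure_subadditive_finite) auto
  also have "\<dots> \<le> (\<Sum>i\<in>I. b i)"
    by (intro sum_mono assms)
  finally show ?thesis .
qed

text \<open>Restricting the inclusion to the support makes almost sure facts, such as every drawn
  function being a permutation, available in the comparison.\<close>

lemma prob_mono_pmf: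
  assumes "\<And>x. x \<in> set_pmf p \<Longrightarrow> x \<in> A \<Longrightarrow> x \<in> B"
  shows "measure_pmf.prob p A \<le> measure_pmf.prob p B"
  using assms by (intro measure_pmf.finite_measure_mono_AE AE_pmfI) auto

section \<open>Random permutations\<close>

lemma card_Collect_eq_sum:
  "finite A \<Longrightarrow> card {x \<in> A. P x} = (\<Sum>x\<in>A. if P x then 1 else 0)"
  by (simp add: sum.If_cases Collect_conj_eq)

text \<open>Double counting of the pairs of a permutation mapping \<open>U\<close> into
  \<open>T\<close> and a further point \<open>y\<close> outside \<open>U\<close> that it also sends
  into \<open>T\<close>. All \<open>y\<close> contribute equally by symmetry, and every such
  permutation admits exactly \<open>card T - card U\<close> of them.\<close>

lemma card_permutes_into_insert:
  assumes A: "finite A" and x: "x \<in> A - U" and U: "U \<subseteq> A" and T: "T \<subseteq> A"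
  shows "(card A - card U) * card {\<pi>. \<pi> permutes A \<and> \<pi> ` insert x U \<subseteq> T}
       = (card T - card U) * card {\<pi>. \<pi> permutes A \<and> \<pi> ` U \<subseteq> T}"
proof -
  define F where "F U = {\<pi>. \<pi> permutes A \<and> \<pi> ` U \<subseteq> T}" for U
  have finF: "finite (F U)" for U
    unfolding F_def using finite_permutations[OF A] by (rule rev_finite_subset) auto
  have finU: "finite U" using A U by (rule rev_finite_subset)
  \<comment> \<open>Precomposition with the transposition of \<open>x\<close> and \<open>y\<close>
    is an involution; it exchanges the two sets because it fixes \<open>U\<close> pointwise.\<close>
  have sym: "card (F (insert y U)) = card (F (insert x U))" if y: "y \<in> A - U" for y
  proof (rule bij_betw_same_card[of "\<lambda>\<pi>. \<pi> \<circ> Transposition.transpose x y"], rule bij_betw_byWitness)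
    have fixU: "Transposition.transpose x y u = u" if "u \<in> U" for u
      using that x y by (auto simp: Transposition.transpose_def)
    have perm: "\<pi> \<circ> Transposition.transpose x y permutes A" if "\<pi> permutes A" for \<pi>
      using that x y by (intro permutes_compose permutes_swap_id) auto
    show "(\<lambda>\<pi>. \<pi> \<circ> Transposition.transpose x y) ` F (insert y U) \<subseteq> F (insert x U)"
      using perm fixU by (auto simp: F_def)
    show "(\<lambda>\<pi>. \<pi> \<circ> Transposition.transpose x y) ` F (insert x U) \<subseteq> F (insert y U)"
      using perm fixU by (auto simp: F_def)
  qed (auto simp: fun_eq_iff)
  have count: "card {y \<in> A - U. \<pi> y \<in> T} = card T - card U" if "\<pi> \<in> F U" for \<pi>
  proof -
    have p: "\<pi> permutes A" and im: "\<pi> ` U \<subseteq> T" using that by (auto simp: F_def)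
    have "{y \<in> A. \<pi> y \<in> T} = inv \<pi> ` T"
      using p T permutes_inverses[OF p] permutes_in_image[OF permutes_inv[OF p]]
      by (auto simp: image_iff) (metis)+
    moreover have "card (inv \<pi> ` T) = card T"
      using permutes_inj[OF permutes_inv[OF p]] by (intro card_image) (auto intro: inj_on_subset)
    ultimately have "card {y \<in> A. \<pi> y \<in> T} = card T" by simp
    moreover have "{y \<in> A - U. \<pi> y \<in> T} = {y \<in> A. \<pi> y \<in> T} - U" by auto
    moreover have "U \<subseteq> {y \<in> A. \<pi> y \<in> T}" using U im by auto
    ultimately show ?thesis using finU by (simp add: card_Diff_subset)
  qed
  have "(card A - card U) * card (F (insert x U)) = (\<Sum>y\<in>A - U. card (F (insert y U)))"
    using sym U finU by (simp add: card_Diff_subset)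
  also have "\<dots> = (\<Sum>y\<in>A - U. \<Sum>\<pi>\<in>F U. if \<pi> y \<in> T then 1 else 0)"
  proof (rule sum.cong[OF refl])
    fix y
    have "F (insert y U) = {\<pi> \<in> F U. \<pi> y \<in> T}" by (auto simp: F_def)
    then show "card (F (insert y U)) = (\<Sum>\<pi>\<in>F U. if \<pi> y \<in> T then 1 else 0)"
      using finF by (simp add: card_Collect_eq_sum)
  qed
  also have "\<dots> = (\<Sum>\<pi>\<in>F U. \<Sum>y\<in>A - U. if \<pi> y \<in> T then 1 else 0)"
    by (rule sum.swap)
  also have "\<dots> = (\<Sum>\<pi>\<in>F U. card {y \<in> A - U. \<pi> y \<in> T})"
    using A by (simp add: card_Collect_eq_sum del: Diff_iff)
  also have "\<dots> = (card T - card U) * card (F U)"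
    using count by simp
  finally show ?thesis by (simp add: F_def)
qed

text \<open>Sampling without replacement is no more likely to stay inside \<open>T\<close> than
  sampling with replacement. Denominators are cleared so that the induction stays in the natural
  numbers.\<close>

lemma card_permutes_into_le:
  assumes A: "finite A" and U: "U \<subseteq> A" and T: "T \<subseteq> A"
  shows "card {\<pi>. \<pi> permutes A \<and> \<pi> ` U \<subseteq> T} * card A ^ card U \<le> card T ^ card U * fact (card A)"
proof -
  have "finite U" using A U by (rule rev_finite_subset)
  then show ?thesis using U
  proof (induction U rule: finite_induct)
    case empty
    then show ?case by (simp add: card_permutations[OF refl A])
  next
    case (insert x U)
    define f where "f = card {\<pi>. \<pi> permutes A \<and> \<pi> ` U \<subseteq> T}"
    define g where "g = card {\<pi>. \<pi> permutes A \<and> \<pi> ` insert x U \<subseteq> T}"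
    have IH: "f * card A ^ card U \<le> card T ^ card U * fact (card A)"
      using insert by (simp add: f_def)
    have step: "(card A - card U) * g = (card T - card U) * f"
      unfolding f_def g_def using insert by (intro card_permutes_into_insert A T) auto
    have TA: "card T \<le> card A" by (rule card_mono[OF A T])
    have UA: "card U < card A"
      using insert by (intro psubset_card_mono A) auto
    \<comment> \<open>This is \<open>(t - u) / (a - u) \<le> t / a\<close> for
      \<open>t \<le> a\<close>; truncated subtraction is harmless, since the left side is then
      0.\<close>
    have "(card T - card U) * card A \<le> card T * (card A - card U)"
      using mult_le_mono2[OF TA, of "card U"]
      by (simp add: diff_mult_distrib diff_mult_distrib2 mult.commute diff_le_mono2)
    have "(card A - card U) * (g * card A) = (card T - card U) * card A * f"
      using step by (metis mult.assoc mult.commute)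
    also have "\<dots> \<le> card T * (card A - card U) * f"
      by (rule mult_le_mono1) fact
    also have "\<dots> = (card A - card U) * (card T * f)"
      by (simp only: ac_simps)
    finally have "(card A - card U) * (g * card A) \<le> (card A - card U) * (card T * f)" .
    then have "g * card A \<le> card T * f"
      using UA by simp
    then have "g * card A ^ Suc (card U) \<le> card T * (f * card A ^ card U)"
      by (metis mult.assoc mult_le_mono1 power_Suc)
    also have "\<dots> \<le> card T * (card T ^ card U * fact (card A))"
      using IH by simp
    finally show ?case
      using insert by (simp add: g_def mult_ac)
  qed
qed

lemma prob_permutation_avoids_le:
  assumes "U \<subseteq> {..<d}" "R \<subseteq> {..<d}" "0 < d"
  shows "measure_pmf.prob (pmf_of_set {\<pi>. \<pi> permutes {..<d}}) {\<pi>. \<forall>i\<in>U. \<pi> i \<notin> R}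
       \<le> (1 - real (card R) / real d) ^ card U"
proof -
  define T where "T = {..<d} - R"
  have fin: "finite {\<pi>. \<pi> permutes {..<d}}" by (simp add: finite_permutations)
  have ne: "{\<pi>. \<pi> permutes {..<d}} \<noteq> {}" using permutes_id by blast
  have "real (card R) \<le> real d" using card_mono[OF _ assms(2)] by simp
  moreover have "card T = d - card R"
    using assms(2) by (simp add: T_def card_Diff_subset finite_subset)
  ultimately have T: "real (card T) / real d = 1 - real (card R) / real d"
    using assms(3) by (simp add: of_nat_diff field_simps)
  have "{\<pi>. \<pi> permutes {..<d}} \<inter> {\<pi>. \<forall>i\<in>U. \<pi> i \<notin> R} = {\<pi>. \<pi> permutes {..<d} \<and> \<pi> ` U \<subseteq> T}"
  proof (intro set_eqI iffI)
    fix \<pi>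
    assume \<pi>: "\<pi> \<in> {\<pi>. \<pi> permutes {..<d}} \<inter> {\<pi>. \<forall>i\<in>U. \<pi> i \<notin> R}"
    then have "\<pi> i \<in> {..<d}" if "i \<in> U" for i
      using permutes_in_image[of \<pi> "{..<d}" i] that assms(1) by blast
    with \<pi> show "\<pi> \<in> {\<pi>. \<pi> permutes {..<d} \<and> \<pi> ` U \<subseteq> T}"
      by (auto simp: T_def)
  qed (auto simp: T_def)
  then have "measure_pmf.prob (pmf_of_set {\<pi>. \<pi> permutes {..<d}}) {\<pi>. \<forall>i\<in>U. \<pi> i \<notin> R}
      = real (card {\<pi>. \<pi> permutes {..<d} \<and> \<pi> ` U \<subseteq> T}) / fact d"
    using measure_pmf_of_set[OF ne fin] by (simp add: card_permutations[of "{..<d}" d])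
  also have "\<dots> \<le> (real (card T) / real d) ^ card U"
  proof -
    have "card {\<pi>. \<pi> permutes {..<d} \<and> \<pi> ` U \<subseteq> T} * d ^ card U \<le> card T ^ card U * fact d"
      using card_permutes_into_le[of "{..<d}" U T] assms by (auto simp: T_def)
    from of_nat_mono[OF this, where ?'a = real]
    have "real (card {\<pi>. \<pi> permutes {..<d} \<and> \<pi> ` U \<subseteq> T}) * real d ^ card U
        \<le> real (card T) ^ card U * fact d"
      by simp
    then show ?thesis
      using assms(3) by (simp add: power_divide pos_divide_le_eq pos_le_divide_eq)
  qed
  finally show ?thesis by (simp add: T)
qed

text \<open>Given the successes, the permutation bound applies to the successful indices in
  \<open>S\<close>. Averaging over the independent successes turns each index of \<open>S\<close>
  into a factor \<open>1 - \<alpha> * r\<close>, and \<open>1 - t \<le> exp (- t)\<close>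
  finishes.\<close>

lemma prob_edge_avoids_le:
  assumes S: "S \<subseteq> {..<d}" and R: "R \<subseteq> {..<d}" and "0 < d" "0 \<le> \<alpha>" "\<alpha> \<le> 1"
  shows "measure_pmf.prob (edge_pmf d \<alpha>) {(\<pi>, u). \<forall>i\<in>S. u i \<longrightarrow> \<pi> i \<notin> R}
       \<le> exp (- \<alpha> * real (card S) * real (card R) / real d)"
proof -
  define r where "r = real (card R) / real d"
  have r: "0 \<le> r" "r \<le> 1"
    using card_mono[OF _ R] \<open>0 < d\<close> by (auto simp: r_def)
  \<comment> \<open>This is \<open>1 - r\<close> to the number of successful indices in
    \<open>S\<close>, written as a product over all indices so that its expectation
    factorises.\<close>
  define g where "g u = (\<Prod>i<d. if i \<in> S \<and> u i then 1 - r else 1)" for u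
  define B where "B = Pi_pmf {..<d} False (\<lambda>_. bernoulli_pmf \<alpha>)"
  define A where "A = {(\<pi>, u). \<forall>i\<in>S. u i \<longrightarrow> \<pi> i \<notin> R}"
  have eq: "edge_pmf d \<alpha> = bind_pmf B (\<lambda>u. map_pmf (\<lambda>\<pi>. (\<pi>, u)) (pmf_of_set {\<pi>. \<pi> permutes {..<d}}))"
    unfolding edge_pmf_def B_def
    by (subst pair_commute_pmf) (simp add: pair_pmf_def map_pmf_def bind_assoc_pmf bind_return_pmf)
  have fin: "finite (set_pmf B)"
    unfolding B_def by (subst set_Pi_pmf) (auto intro!: finite_PiE_dflt)
  have "measure_pmf.prob (edge_pmf d \<alpha>) A \<le> measure_pmf.expectation B g"
    unfolding eq
  proof (rule prob_bind_pmf_le_expectation)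
    show "integrable (measure_pmf B) g" using fin by (rule integrable_measure_pmf_finite)
    fix u
    have "measure_pmf.prob (map_pmf (\<lambda>\<pi>. (\<pi>, u)) (pmf_of_set {\<pi>. \<pi> permutes {..<d}})) A
        = measure_pmf.prob (pmf_of_set {\<pi>. \<pi> permutes {..<d}}) {\<pi>. \<forall>i\<in>{i\<in>S. u i}. \<pi> i \<notin> R}"
      by (simp add: A_def vimage_def Ball_def imp_conjL)
    also have "\<dots> \<le> (1 - r) ^ card {i\<in>S. u i}"
      unfolding r_def using S R \<open>0 < d\<close> by (intro prob_permutation_avoids_le) auto
    also have "{i\<in>S. u i} = {..<d} \<inter> {i. i \<in> S \<and> u i}" using S by auto
    then have "(1 - r) ^ card {i\<in>S. u i} = g u"
      by (simp add: g_def prod.If_cases)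
    finally show "measure_pmf.prob (map_pmf (\<lambda>\<pi>. (\<pi>, u)) (pmf_of_set {\<pi>. \<pi> permutes {..<d}})) A \<le> g u" .
  qed
  also have "measure_pmf.expectation B g
      = (\<Prod>i<d. measure_pmf.expectation (bernoulli_pmf \<alpha>) (\<lambda>b. if i \<in> S \<and> b then 1 - r else 1))"
    unfolding B_def g_def
    by (rule expectation_prod_Pi_pmf) (use r in \<open>auto intro: integrable_measure_pmf_finite\<close>)
  also have "\<dots> = (\<Prod>i<d. if i \<in> S then 1 - \<alpha> * r else 1)"
    using assms by (intro prod.cong refl) (auto simp: algebra_simps)
  also have "\<dots> = (1 - \<alpha> * r) ^ card S"
    using S by (simp add: prod.If_cases Int_absorb1)
  also have "\<dots> \<le> exp (- (\<alpha> * r)) ^ card S"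
    using r assms exp_ge_add_one_self[of "- (\<alpha> * r)"] by (intro power_mono) (auto simp: mult_le_one)
  also have "\<dots> = exp (- \<alpha> * real (card S) * real (card R) / real d)"
    by (simp add: exp_of_nat_mult[symmetric] r_def)
  finally show ?thesis by (simp add: A_def)
qed

section \<open>Percolation on a multigraph of bounded degree\<close>

text \<open>Undirected adjacency that still names the arc: \<open>mk_symmetric\<close> merges
  parallel arcs, whereas percolation treats each arc separately.\<close>

definition joins :: "('v, 'c) pre_digraph \<Rightarrow> 'c \<Rightarrow> 'v \<Rightarrow> 'v \<Rightarrow> bool" where
  "joins G c x y \<longleftrightarrow>
     c \<in> arcs G \<and> (tail G c = x \<and> head G c = y \<or> head G c = x \<and> tail G c = y)"

lemma joins_restrict_arcs:
  "Q \<subseteq> arcs G \<Longrightarrow> joins (G\<lparr>arcs := Q\<rparr>) c x y \<longleftrightarrow> joins G c x y \<and> c \<in> Q"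
  by (auto simp: joins_def)

lemma arcs_ends_mk_symmetric:
  "(x, y) \<in> arcs_ends (with_proj (mk_symmetric G)) \<longleftrightarrow> (\<exists>c. joins G c x y)"
  by (auto simp: mk_symmetric_def joins_def)

lemma component_of_step:
  assumes "x \<in> component_of G s" "joins G c x y" "y \<in> verts G"
  shows "y \<in> component_of G s"
proof -
  have "(x, y) \<in> arcs_ends (with_proj (mk_symmetric G))"
    using assms(2) arcs_ends_mk_symmetric by metis
  then show ?thesis
    using assms unfolding component_of_def reachable_def
    by (auto intro: rtrancl_on_into_rtrancl_on)
qed

lemma component_of_refl: "s \<in> verts G \<Longrightarrow> s \<in> component_of G s"
  by (simp add: component_of_def reachable_def)

lemma component_of_subset:
  assumes "s \<in> X" and "\<And>c x y. joins G c x y \<Longrightarrow> x \<in> X \<Longrightarrow> y \<in> X"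
  shows "component_of G s \<subseteq> X"
proof
  fix t assume "t \<in> component_of G s"
  then have "(s, t) \<in> rtrancl_on (verts (with_proj (mk_symmetric G))) (arcs_ends (with_proj (mk_symmetric G)))"
    by (simp add: component_of_def reachable_def)
  then show "t \<in> X"
  proof (induction rule: rtrancl_on_induct)
    case (step y z)
    then obtain c where "joins G c y z" using arcs_ends_mk_symmetric by metis
    then show ?case using assms(2) step by blast
  qed (use assms(1) in simp)
qed

text \<open>The last arc traversed comes first. Vertices may repeat but arcs may not, so a trail of
  length \<open>l\<close> requires exactly \<open>l\<close> different arcs to be kept.\<close>

inductive trail :: "('v, 'c) pre_digraph \<Rightarrow> 'v \<Rightarrow> 'c list \<Rightarrow> 'v \<Rightarrow> bool" for G s where
  Nil: "trail G s [] s"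
| Cons: "trail G s cs x \<Longrightarrow> joins G c x y \<Longrightarrow> c \<notin> set cs \<Longrightarrow> trail G s (c # cs) y"

lemma trail_distinct: "trail G s cs x \<Longrightarrow> distinct cs \<and> set cs \<subseteq> arcs G"
  by (induction rule: trail.induct) (auto simp: joins_def)

text \<open>Instead of shortening walks, the proof takes the largest set all of whose points are
  reached by trails of kept arcs running inside the set, and shows that no kept arc leaves
  it.\<close>

lemma component_of_trail:
  assumes "x \<in> component_of (G\<lparr>arcs := Q\<rparr>) s" "Q \<subseteq> arcs G"
  shows "\<exists>cs. trail G s cs x \<and> set cs \<subseteq> Q"
proof -
  \<comment> \<open>The condition on endpoints guarantees that an arc leaving \<open>X\<close> has
    not been used by any of these trails. The union of good sets is again good.\<close>
  define good where "good X \<longleftrightarrow> s \<in> X \<and> (\<forall>x\<in>X. \<exists>cs. trail G s cs x \<and> set cs \<subseteq> Q \<and>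
      (\<forall>c\<in>set cs. tail G c \<in> X \<and> head G c \<in> X))" for X
  define X where "X = \<Union>{Y. good Y}"
  have "good {s}" by (auto simp: good_def intro: trail.Nil)
  then have s: "s \<in> X" by (auto simp: X_def)
  have trailX: "\<exists>cs. trail G s cs x \<and> set cs \<subseteq> Q \<and> (\<forall>c\<in>set cs. tail G c \<in> X \<and> head G c \<in> X)"
    if "x \<in> X" for x
  proof -
    from that obtain Y where "good Y" "x \<in> Y" by (auto simp: X_def)
    moreover from \<open>good Y\<close> have "Y \<subseteq> X" by (auto simp: X_def)
    ultimately show ?thesis unfolding good_def by blast
  qed
  have "component_of (G\<lparr>arcs := Q\<rparr>) s \<subseteq> X"
  proof (rule component_of_subset[OF s], rule ccontr)
    fix c x y
    assume "joins (G\<lparr>arcs := Q\<rparr>) c x y" and x: "x \<in> X" and y: "y \<notin> X"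
    then have c: "joins G c x y" "c \<in> Q" using assms(2) by (auto simp: joins_restrict_arcs)
    have "\<exists>cs. trail G s cs z \<and> set cs \<subseteq> Q \<and>
        (\<forall>c\<in>set cs. tail G c \<in> insert y X \<and> head G c \<in> insert y X)" if "z \<in> insert y X" for z
    proof (cases "z = y")
      case True
      from trailX[OF x] obtain cs where cs: "trail G s cs x" "set cs \<subseteq> Q"
          "\<forall>c\<in>set cs. tail G c \<in> X \<and> head G c \<in> X" by blast
      \<comment> \<open>\<open>c\<close> is a new arc, because it has the endpoint \<open>y\<close> outside \<open>X\<close>.\<close>
      have "c \<notin> set cs" using cs(3) c(1) y by (auto simp: joins_def)
      then have "trail G s (c # cs) y" using cs(1) c(1) by (intro trail.Cons)
      moreover have "tail G c \<in> insert y X \<and> head G c \<in> insert y X"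
        using c(1) x by (auto simp: joins_def)
      ultimately show ?thesis
        using True cs c(2) by (intro exI[of _ "c # cs"]) auto
    next
      case False
      then show ?thesis using trailX[of z] that by blast
    qed
    then have "good (insert y X)" unfolding good_def using s by blast
    then show False using y by (auto simp: X_def)
  qed
  then show ?thesis using assms(1) trailX by blast
qed

text \<open>A trail of length \<open>n + 1\<close> is a trail of length \<open>n\<close> with one of
  at most \<open>k\<close> continuations. Finiteness is carried along because \<open>card\<close> is
  0 on infinite sets.\<close>

lemma trails_card_le:
  assumes "\<And>x. finite {(c, y). joins G c x y} \<and> card {(c, y). joins G c x y} \<le> k"
  shows "finite {(cs, x). trail G s cs x \<and> length cs = n}
       \<and> card {(cs, x). trail G s cs x \<and> length cs = n} \<le> k ^ n"
proof (induction n)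
  case 0
  have "{(cs, x). trail G s cs x \<and> length cs = 0} = {([], s)}"
    by (auto intro: trail.Nil elim: trail.cases)
  then show ?case by simp
next
  case (Suc n)
  define W where "W = {(cs, x). trail G s cs x \<and> length cs = n}"
  define I where "I = (SIGMA w:W. {(c, y). joins G c (snd w) y})"
  have fin: "finite I" using Suc assms by (auto simp: I_def W_def)
  have sub: "{(cs, x). trail G s cs x \<and> length cs = Suc n} \<subseteq> (\<lambda>(w, c, y). (c # fst w, y)) ` I"
  proof clarify
    fix cs x assume "trail G s cs x" "length cs = Suc n"
    then obtain c cs' y where "cs = c # cs'" "trail G s cs' y" "joins G c y x" "length cs' = n"
      by (auto elim: trail.cases)
    then show "(cs, x) \<in> (\<lambda>(w, c, y). (c # fst w, y)) ` I"
      by (intro image_eqI[of _ _ "((cs', y), c, x)"]) (auto simp: I_def W_def)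
  qed
  have "card {(cs, x). trail G s cs x \<and> length cs = Suc n} \<le> card I"
    using surj_card_le[OF fin sub] .
  also have "\<dots> = (\<Sum>w\<in>W. card {(c, y). joins G c (snd w) y})"
    unfolding I_def using Suc assms by (intro card_SigmaI) (auto simp: W_def)
  also have "\<dots> \<le> (\<Sum>w\<in>W. k)"
    using assms by (intro sum_mono) blast
  also have "\<dots> \<le> k ^ Suc n"
    using Suc by (simp add: W_def mult.commute)
  finally show ?case using finite_subset[OF sub] fin by simp
qed

lemma sum_power_le_geometric:
  fixes q :: real
  assumes "0 \<le> q" "q < 1"
  shows "(\<Sum>n\<le>M. q ^ n) \<le> 1 / (1 - q)"
  using assms by (simp add: sum_gp0 divide_right_mono)

text \<open>First moment method: the component is no larger than the number of trails from
  \<open>s\<close> whose arcs are all kept, and the expected number of these is bounded by a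
  geometric series.\<close>

lemma percolation_component_card:
  fixes P :: "'c set pmf"
  assumes fin: "finite (arcs G)"
    and deg: "\<And>x. finite {(c, y). joins G c x y} \<and> card {(c, y). joins G c x y} \<le> k"
    and sub: "\<And>Q. Q \<in> set_pmf P \<Longrightarrow> Q \<subseteq> arcs G"
    and prob: "\<And>D. D \<subseteq> arcs G \<Longrightarrow> measure_pmf.prob P {Q. D \<subseteq> Q} \<le> \<alpha> ^ card D"
    and "0 \<le> \<alpha>" "\<alpha> * real k < 1" "0 < n"
  shows "measure_pmf.prob P {Q. n \<le> card (component_of (G\<lparr>arcs := Q\<rparr>) s)} \<le> 1 / (1 - \<alpha> * real k) / real n"
proof -
  define W where "W l = {(cs, x). trail G s cs x \<and> length cs = l}" for l
  define F where "F = {(cs, x). trail G s cs x}"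
  define Z where "Z Q = (\<Sum>w\<in>F. indicator {Q. set (fst w) \<subseteq> Q} Q :: real)" for Q
  have finP: "finite (set_pmf P)"
    using sub fin by (intro finite_subset[of "set_pmf P" "Pow (arcs G)"]) auto
  have len: "length cs \<le> card (arcs G)" if "trail G s cs x" for cs x
    using trail_distinct[OF that] fin by (metis card_mono distinct_card)
  then have F: "F = (\<Union>l\<le>card (arcs G). W l)" by (auto simp: F_def W_def)
  have W: "finite (W l)" "card (W l) \<le> k ^ l" for l
    using trails_card_le[OF deg] by (auto simp: W_def)
  have finF: "finite F" unfolding F using W by simp
  \<comment> \<open>Markov's inequality in pointwise form, with \<open>Z Q\<close> the number of
    trails inside \<open>Q\<close>.\<close>
  have "indicator {Q. n \<le> card (component_of (G\<lparr>arcs := Q\<rparr>) s)} Q \<le> Z Q / real n"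
    if "Q \<in> set_pmf P" for Q
  proof (cases "n \<le> card (component_of (G\<lparr>arcs := Q\<rparr>) s)")
    case True
    have "component_of (G\<lparr>arcs := Q\<rparr>) s \<subseteq> snd ` {w \<in> F. set (fst w) \<subseteq> Q}"
      using component_of_trail[OF _ sub[OF that]] by (force simp: F_def)
    then have "n \<le> card {w \<in> F. set (fst w) \<subseteq> Q}"
      using True finF surj_card_le[of "{w \<in> F. set (fst w) \<subseteq> Q}"] by fastforce
    also have "real (card {w \<in> F. set (fst w) \<subseteq> Q}) = Z Q"
      using finF by (simp add: Z_def card_Collect_eq_sum indicator_def of_bool_def if_distrib cong: if_cong)
    finally show ?thesis using True \<open>0 < n\<close> by simp
  qed (simp add: Z_def sum_nonneg)
  then have "measure_pmf.expectation P (indicator {Q. n \<le> card (component_of (G\<lparr>arcs := Q\<rparr>) s)})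
      \<le> measure_pmf.expectation P (\<lambda>Q. Z Q / real n)"
    by (intro integral_mono_AE AE_pmfI integrable_measure_pmf_finite finP)
  also have "\<dots> = (\<Sum>w\<in>F. measure_pmf.prob P {Q. set (fst w) \<subseteq> Q}) / real n"
    by (simp add: Z_def Bochner_Integration.integral_sum integrable_measure_pmf_finite[OF finP])
  also have "\<dots> \<le> (\<Sum>w\<in>F. \<alpha> ^ length (fst w)) / real n"
  proof (intro divide_right_mono sum_mono)
    fix w assume "w \<in> F"
    then have "distinct (fst w)" "set (fst w) \<subseteq> arcs G"
      using trail_distinct[of G s "fst w" "snd w"] by (auto simp: F_def)
    then show "measure_pmf.prob P {Q. set (fst w) \<subseteq> Q} \<le> \<alpha> ^ length (fst w)"
      using prob by (metis distinct_card)
  qed simp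
  also have "(\<Sum>w\<in>F. \<alpha> ^ length (fst w)) = (\<Sum>l\<le>card (arcs G). \<Sum>w\<in>W l. \<alpha> ^ length (fst w))"
    unfolding F using W by (intro sum.UNION_disjoint) (auto simp: W_def)
  also have "\<dots> = (\<Sum>l\<le>card (arcs G). real (card (W l)) * \<alpha> ^ l)"
  proof (rule sum.cong[OF refl])
    fix l
    have "(\<Sum>w\<in>W l. \<alpha> ^ length (fst w)) = (\<Sum>w\<in>W l. \<alpha> ^ l)"
      by (intro sum.cong) (auto simp: W_def)
    then show "(\<Sum>w\<in>W l. \<alpha> ^ length (fst w)) = real (card (W l)) * \<alpha> ^ l" by simp
  qed
  also have "\<dots> \<le> (\<Sum>l\<le>card (arcs G). (\<alpha> * real k) ^ l)"
  proof (rule sum_mono)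
    fix l
    have "real (card (W l)) \<le> real k ^ l" using W(2)[of l] by (metis of_nat_le_iff of_nat_power)
    then show "real (card (W l)) * \<alpha> ^ l \<le> (\<alpha> * real k) ^ l"
      using \<open>0 \<le> \<alpha>\<close> by (simp add: power_mult_distrib mult.commute mult_left_mono)
  qed
  also have "\<dots> \<le> 1 / (1 - \<alpha> * real k)"
    using assms by (intro sum_power_le_geometric) auto
  finally show ?thesis by (simp add: divide_right_mono)
qed

section \<open>The subcritical regime\<close>

lemma finite_homotopy_edges: "finite (homotopy_edges m N)"
  by (rule finite_subset[of _ "{..<N} \<times> {..<N} \<times> {..<m}"]) (auto simp: homotopy_edges_def)

text \<open>The default value \<open>id\<close> is itself a permutation, so the first claim holds
  for every triple and not only for homotopy edges.\<close>

lemma set_Pi_pmf_permutations: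
  fixes d :: nat
  assumes "\<pi> \<in> set_pmf (Pi_pmf (homotopy_edges m N) id (\<lambda>_. pmf_of_set {\<pi>. \<pi> permutes {..<d}}))"
  shows "\<pi> e permutes {..<d} \<and> (e \<notin> homotopy_edges m N \<longrightarrow> \<pi> e = id)"
proof -
  have "{\<pi>. \<pi> permutes {..<d}} \<noteq> {}" using permutes_id by blast
  then have "set_pmf (pmf_of_set {\<pi>. \<pi> permutes {..<d}}) = {\<pi>. \<pi> permutes {..<d}}"
    by (rule set_pmf_of_set) (simp add: finite_permutations)
  then show ?thesis
    using assms by (cases "e \<in> homotopy_edges m N")
      (auto simp: set_Pi_pmf finite_homotopy_edges PiE_dflt_def permutes_id
        simp del: split_paired_All dest!: spec[of _ e])
qed

text \<open>The conditional law of the outcome given the bijections \<open>\<pi>\<close>.\<close>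

definition successes_pmf ::
  "nat \<Rightarrow> nat \<Rightarrow> nat \<Rightarrow> real \<Rightarrow> (homotopy_edge \<Rightarrow> nat \<Rightarrow> nat) \<Rightarrow> outcome pmf" where
  "successes_pmf m N d \<alpha> \<pi> =
     Pi_pmf (homotopy_edges m N) (id, \<lambda>_. False)
       (\<lambda>e. map_pmf (Pair (\<pi> e)) (Pi_pmf {..<d} False (\<lambda>_. bernoulli_pmf \<alpha>)))"

lemma outcome_pmf_conv_bind:
  "outcome_pmf m N d \<alpha> =
     bind_pmf (Pi_pmf (homotopy_edges m N) id (\<lambda>_. pmf_of_set {\<pi>. \<pi> permutes {..<d}}))
       (successes_pmf m N d \<alpha>)"
proof -
  have "edge_pmf d \<alpha> = bind_pmf (pmf_of_set {\<pi>. \<pi> permutes {..<d}})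
      (\<lambda>\<pi>. map_pmf (Pair \<pi>) (Pi_pmf {..<d} False (\<lambda>_. bernoulli_pmf \<alpha>)))"
    by (simp add: edge_pmf_def pair_pmf_def map_pmf_def)
  then show ?thesis
    unfolding outcome_pmf_def successes_pmf_def
    by (simp add: Pi_pmf_bind[OF finite_homotopy_edges, where d' = id])
qed

lemma fst_successes_pmf:
  assumes "\<omega> \<in> set_pmf (successes_pmf m N d \<alpha> \<pi>)" "\<And>e. e \<notin> homotopy_edges m N \<Longrightarrow> \<pi> e = id"
  shows "fst (\<omega> e) = \<pi> e"
  using assms by (cases "e \<in> homotopy_edges m N")
    (auto simp: successes_pmf_def set_Pi_pmf finite_homotopy_edges PiE_dflt_def
      simp del: split_paired_All dest!: spec[of _ e])

text \<open>Once the bijections are fixed, randomness affects only the set of arcs. As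
  \<open>head\<close> is a total function, agreement with \<open>\<pi>\<close> is required at every
  triple.\<close>

lemma solution_graph_restrict_arcs:
  assumes "\<And>e. fst (\<omega> e) = \<pi> e"
  shows "solution_graph m N d \<omega>
       = (solution_graph m N d (\<lambda>e. (\<pi> e, \<lambda>_. True)))\<lparr>arcs := arcs (solution_graph m N d \<omega>)\<rparr>"
  by (simp add: solution_graph_def assms)

lemma solution_graph_degree:
  fixes \<pi> :: "homotopy_edge \<Rightarrow> nat \<Rightarrow> nat" and m N d :: nat
  assumes "\<And>e. \<pi> e permutes {..<d}"
  defines "G \<equiv> solution_graph m N d (\<lambda>e. (\<pi> e, \<lambda>_. True))"
  shows "finite {(c, y). joins G c x y} \<and> card {(c, y). joins G c x y} \<le> N * m"
proof -
  obtain v j where x: "x = (v, j)" by force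
  \<comment> \<open>A neighbour is determined by its node \<open>w\<close> and the number
    \<open>k\<close> of the parallel edge. Correspondences are indexed at the smaller node, so the
    inverse bijection appears when \<open>v\<close> is the larger one; the value at
    \<open>w = v\<close> only enlarges the image.\<close>
  define f where "f = (\<lambda>(w, k). if v < w then (((v, w, k), j), (w, \<pi> (v, w, k) j))
      else (((w, v, k), inv (\<pi> (w, v, k)) j), (w, inv (\<pi> (w, v, k)) j)))"
  have "{(c, y). joins G c x y} \<subseteq> f ` ({..<N} \<times> {..<m})"
  proof clarify
    fix a b k i w l
    assume J: "joins G ((a, b, k), i) x (w, l)"
    then have ab: "a < b" "b < N" "k < m" by (auto simp: joins_def G_def solution_graph_def homotopy_edges_def)
    have inv: "inv (\<pi> e) (\<pi> e i) = i" for e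
      using permutes_inverses(2)[OF assms(1)] .
    from J consider "a = v" "i = j" "w = b" "l = \<pi> (a, b, k) i" | "b = v" "\<pi> (a, b, k) i = j" "w = a" "l = i"
      by (auto simp: joins_def G_def solution_graph_def x)
    then show "(((a, b, k), i), (w, l)) \<in> f ` ({..<N} \<times> {..<m})"
    proof cases
      case 1
      then show ?thesis using ab by (intro image_eqI[of _ _ "(b, k)"]) (auto simp: f_def)
    next
      case 2
      then show ?thesis using ab inv by (intro image_eqI[of _ _ "(a, k)"]) (auto simp: f_def)
    qed
  qed
  then show ?thesis
    using surj_card_le[of "{..<N} \<times> {..<m}" _ f] finite_surj[of "{..<N} \<times> {..<m}" _ f] by simp
qed

lemma finite_arcs_solution_graph: "finite (arcs (solution_graph m N d \<omega>))"
  by (rule finite_subset[of _ "homotopy_edges m N \<times> {..<d}"])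
    (auto simp: solution_graph_def finite_homotopy_edges)

text \<open>Independence is used twice, across the homotopy edges and then across the
  correspondences of one edge; \<open>D' e\<close> is the fibre of \<open>D\<close> over
  \<open>e\<close>.\<close>

lemma prob_all_successful:
  assumes "0 \<le> \<alpha>" "\<alpha> \<le> 1" "D \<subseteq> homotopy_edges m N \<times> {..<d}"
  shows "measure_pmf.prob (successes_pmf m N d \<alpha> \<pi>) {\<omega>. D \<subseteq> arcs (solution_graph m N d \<omega>)}
       = \<alpha> ^ card D"
proof -
  define E where "E = homotopy_edges m N"
  have finE: "finite E" by (simp add: E_def finite_homotopy_edges)
  define D' where "D' e = D `` {e}" for e
  have D': "D' e \<subseteq> {..<d}" for e using assms(3) by (auto simp: D'_def)
  have one: "measure_pmf.prob (Pi_pmf {..<d} False (\<lambda>_. bernoulli_pmf \<alpha>)) {u. \<forall>i\<in>D' e. u i}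
      = \<alpha> ^ card (D' e)" for e
  proof -
    have "{u. \<forall>i\<in>D' e. u i} = Pi {..<d} (\<lambda>i. if i \<in> D' e then {True} else UNIV)"
      using D'[of e] by (auto simp: Pi_def subset_iff)
    then have "measure_pmf.prob (Pi_pmf {..<d} False (\<lambda>_. bernoulli_pmf \<alpha>)) {u. \<forall>i\<in>D' e. u i}
      = (\<Prod>i<d. if i \<in> D' e then \<alpha> else 1)"
      using assms by (auto simp: measure_Pi_pmf_Pi measure_pmf_single intro!: prod.cong)
    also have "\<dots> = \<alpha> ^ card (D' e)"
      using D'[of e] by (simp add: prod.If_cases Int_absorb1)
    finally show ?thesis .
  qed
  have "{\<omega>. D \<subseteq> arcs (solution_graph m N d \<omega>)} = Pi E (\<lambda>e. {p. \<forall>i\<in>D' e. snd p i})"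
    using assms(3) by (fastforce simp: solution_graph_def E_def D'_def Pi_def)
  then have "measure_pmf.prob (successes_pmf m N d \<alpha> \<pi>) {\<omega>. D \<subseteq> arcs (solution_graph m N d \<omega>)}
      = (\<Prod>e\<in>E. \<alpha> ^ card (D' e))"
    using one by (simp add: successes_pmf_def measure_Pi_pmf_Pi finE vimage_def flip: E_def)
  also have "\<dots> = \<alpha> ^ (\<Sum>e\<in>E. card (D' e))"
    by (simp add: power_sum)
  also have "(\<Sum>e\<in>E. card (D' e)) = card (Sigma E D')"
    using finite_subset[OF D'] by (intro card_SigmaI[symmetric] finE) blast
  also have "Sigma E D' = D"
    using assms(3) by (auto simp: D'_def E_def)
  finally show ?thesis .
qed

lemma component_of_subset_verts: "component_of G s \<subseteq> verts G"
  by (auto simp: component_of_def reachable_def dest: in_rtrancl_on_in_F(2))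

lemma finds_all_solutions_card_component:
  assumes "(s, \<omega>) \<in> finds_all_solutions m N d"
  shows "d \<le> card (component_of (solution_graph m N d \<omega>) s)"
proof -
  from assms obtain v where "{v} \<times> {..<d} \<subseteq> component_of (solution_graph m N d \<omega>) s"
    by (auto simp: finds_all_solutions_def)
  moreover have "finite (component_of (solution_graph m N d \<omega>) s)"
    by (rule finite_subset[OF component_of_subset_verts]) (simp add: solution_graph_def solutions_def)
  ultimately have "card ({v} \<times> {..<d}) \<le> card (component_of (solution_graph m N d \<omega>) s)"
    by (intro card_mono)
  then show ?thesis by (simp add: card_cartesian_product)
qed

text \<open>For a fixed start and fixed bijections this is the percolation bound with degree
  \<open>N * m\<close> and size \<open>d\<close>. The bound depends on neither, so it survives
  averaging.\<close>

lemma prob_finds_all_solutions_le: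
  assumes "0 < d" "0 \<le> \<alpha>" "\<alpha> \<le> 1" "\<alpha> * real (N * m) < 1"
  shows "measure_pmf.prob (model_pmf m N d \<alpha>) (finds_all_solutions m N d)
       \<le> 1 / (1 - \<alpha> * real (N * m)) / real d"
  unfolding model_pmf_def outcome_pmf_conv_bind
proof (intro prob_pair_pmf_le prob_bind_pmf_le)
  fix s \<pi>
  assume "\<pi> \<in> set_pmf (Pi_pmf (homotopy_edges m N) id (\<lambda>_. pmf_of_set {\<pi>. \<pi> permutes {..<d}}))"
  note \<pi> = set_Pi_pmf_permutations[OF this]
  define G where "G = solution_graph m N d (\<lambda>e. (\<pi> e, \<lambda>_. True))"
  define P where "P = map_pmf (\<lambda>\<omega>. arcs (solution_graph m N d \<omega>)) (successes_pmf m N d \<alpha> \<pi>)"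
  have arcsG: "arcs G = homotopy_edges m N \<times> {..<d}"
    by (auto simp: G_def solution_graph_def)
  have "measure_pmf.prob (successes_pmf m N d \<alpha> \<pi>) {\<omega>. (s, \<omega>) \<in> finds_all_solutions m N d}
      \<le> measure_pmf.prob (successes_pmf m N d \<alpha> \<pi>)
          {\<omega>. d \<le> card (component_of (G\<lparr>arcs := arcs (solution_graph m N d \<omega>)\<rparr>) s)}"
  proof (rule prob_mono_pmf)
    fix \<omega> assume \<omega>: "\<omega> \<in> set_pmf (successes_pmf m N d \<alpha> \<pi>)"
      and "\<omega> \<in> {\<omega>. (s, \<omega>) \<in> finds_all_solutions m N d}"
    then have "d \<le> card (component_of (solution_graph m N d \<omega>) s)"
      using finds_all_solutions_card_component by blast
    moreover have "fst (\<omega> e) = \<pi> e" for e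
      using fst_successes_pmf[OF \<omega>] \<pi> by blast
    then have "solution_graph m N d \<omega> = G\<lparr>arcs := arcs (solution_graph m N d \<omega>)\<rparr>"
      unfolding G_def by (rule solution_graph_restrict_arcs)
    ultimately show "\<omega> \<in> {\<omega>. d \<le> card (component_of (G\<lparr>arcs := arcs (solution_graph m N d \<omega>)\<rparr>) s)}"
      by simp
  qed
  also have "\<dots> = measure_pmf.prob P {Q. d \<le> card (component_of (G\<lparr>arcs := Q\<rparr>) s)}"
    by (simp add: P_def vimage_def)
  also have "\<dots> \<le> 1 / (1 - \<alpha> * real (N * m)) / real d"
  proof (rule percolation_component_card)
    show "finite (arcs G)" unfolding G_def by (rule finite_arcs_solution_graph)
    show "finite {(c, y). joins G c x y} \<and> card {(c, y). joins G c x y} \<le> N * m" for x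
      unfolding G_def using \<pi> by (intro solution_graph_degree) blast
    show "Q \<subseteq> arcs G" if "Q \<in> set_pmf P" for Q
      using that by (auto simp: P_def arcsG solution_graph_def)
    show "measure_pmf.prob P {Q. D \<subseteq> Q} \<le> \<alpha> ^ card D" if "D \<subseteq> arcs G" for D
      using prob_all_successful[of \<alpha> D m N d \<pi>] that assms by (simp add: P_def vimage_def arcsG)
  qed (use assms in auto)
  finally show "measure_pmf.prob (successes_pmf m N d \<alpha> \<pi>) {\<omega>. (s, \<omega>) \<in> finds_all_solutions m N d}
      \<le> 1 / (1 - \<alpha> * real (N * m)) / real d" .
qed

section \<open>The supercritical regime\<close>

text \<open>The component meets node \<open>p\<close> in \<open>S\<close> and node \<open>q\<close>
  in \<open>T\<close>, both proper subsets and not both empty. If \<open>T\<close> is no larger than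
  \<open>S\<close>, the witnesses are \<open>S\<close> and the complement of \<open>T\<close>;
  otherwise they are the complement of \<open>S\<close> and \<open>T\<close>.\<close>

lemma not_finds_all_solutions_blocked:
  assumes "p < q" "q < N" "s \<in> solutions N d" "fst s \<in> {p, q}"
    and perm: "\<And>k. k < m \<Longrightarrow> fst (\<omega> (p, q, k)) permutes {..<d}"
    and fail: "(s, \<omega>) \<notin> finds_all_solutions m N d"
  shows "\<exists>S R. S \<subseteq> {..<d} \<and> R \<subseteq> {..<d} \<and> S \<noteq> {} \<and> R \<noteq> {} \<and> d \<le> card S + card R \<and>
    (\<forall>k<m. \<forall>i\<in>S. snd (\<omega> (p, q, k)) i \<longrightarrow> fst (\<omega> (p, q, k)) i \<notin> R)"
proof -
  define G where "G = solution_graph m N d \<omega>"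
  define C where "C = component_of G s"
  define S where "S = {i. i < d \<and> (p, i) \<in> C}"
  define T where "T = {i. i < d \<and> (q, i) \<in> C}"
  have vertsG: "verts G = {..<N} \<times> {..<d}"
    by (simp add: G_def solution_graph_def solutions_def)
  have sub: "S \<subseteq> {..<d}" "T \<subseteq> {..<d}" by (auto simp: S_def T_def)
  have incomplete: "\<exists>i<d. (v, i) \<notin> C" if "v < N" for v
    using fail that by (auto simp: finds_all_solutions_def C_def G_def)
  have psub: "S \<subset> {..<d}" "T \<subset> {..<d}"
    using sub incomplete[of p] incomplete[of q] assms(1,2) by (auto simp: S_def T_def)
  have "s \<in> C" using assms(3) vertsG by (auto simp: C_def solutions_def intro!: component_of_refl)
  then have ne: "S \<noteq> {} \<or> T \<noteq> {}"
    using assms(3,4) by (cases s) (auto simp: S_def T_def solutions_def)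
  \<comment> \<open>A successful correspondence can be followed both ways, hence an equivalence;
    each direction serves one of the two cases below.\<close>
  have iff: "i \<in> S \<longleftrightarrow> fst (\<omega> (p, q, k)) i \<in> T"
    if "k < m" "i < d" "snd (\<omega> (p, q, k)) i" for k i
  proof -
    have j: "fst (\<omega> (p, q, k)) i < d"
      using permutes_in_image[OF perm[OF that(1)], of i] that(2) by simp
    have "joins G ((p, q, k), i) (p, i) (q, fst (\<omega> (p, q, k)) i)"
      "joins G ((p, q, k), i) (q, fst (\<omega> (p, q, k)) i) (p, i)"
      using that assms(1,2) by (auto simp: joins_def G_def solution_graph_def homotopy_edges_def)
    then show ?thesis
      using j that(2) assms(1,2) component_of_step[of _ G s] vertsG
      by (auto simp: S_def T_def C_def)
  qed
  have card: "card ({..<d} - S) = d - card S" "card ({..<d} - T) = d - card T"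
    using sub by (auto simp: card_Diff_subset finite_subset)
  have less: "card S < d" "card T < d"
    using psubset_card_mono[OF _ psub(1)] psubset_card_mono[OF _ psub(2)] by auto
  show ?thesis
  proof (cases "card T \<le> card S")
    case True
    then have "S \<noteq> {}" using ne sub finite_subset[OF sub(2)] by auto
    then show ?thesis
      using True sub psub card less iff
      by (intro exI[of _ S] exI[of _ "{..<d} - T"]) auto
  next
    case False
    then have "T \<noteq> {}" by auto
    then show ?thesis
      using False sub psub card less iff
      by (intro exI[of _ "{..<d} - S"] exI[of _ T]) auto
  qed
qed

text \<open>The \<open>m\<close> parallel edges are independent and each avoids joining
  \<open>S\<close> to \<open>R\<close> with the probability bounded before; all other edges are
  unconstrained.\<close>

lemma prob_blocked_le:
  assumes "p < q" "q < N" "S \<subseteq> {..<d}" "R \<subseteq> {..<d}" "0 < d" "0 \<le> \<alpha>" "\<alpha> \<le> 1"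
  shows "measure_pmf.prob (outcome_pmf m N d \<alpha>)
      {\<omega>. \<forall>k<m. \<forall>i\<in>S. snd (\<omega> (p, q, k)) i \<longrightarrow> fst (\<omega> (p, q, k)) i \<notin> R}
    \<le> exp (- (\<alpha> * real m) * (real (card S) * real (card R) / real d))"
proof -
  define K where "K = (\<lambda>k. (p, q, k)) ` {..<m}"
  define X where "X = {(\<pi>, u). \<forall>i\<in>S. u i \<longrightarrow> \<pi> i \<notin> R}"
  have K: "K \<subseteq> homotopy_edges m N" using assms by (auto simp: K_def homotopy_edges_def)
  have "card K = m" unfolding K_def by (subst card_image) (auto simp: inj_on_def)
  have "{\<omega>. \<forall>k<m. \<forall>i\<in>S. snd (\<omega> (p, q, k)) i \<longrightarrow> fst (\<omega> (p, q, k)) i \<notin> R}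
      = Pi (homotopy_edges m N) (\<lambda>e. if e \<in> K then X else UNIV)"
    using K by (auto simp: K_def X_def Pi_def split_beta)
  then have "measure_pmf.prob (outcome_pmf m N d \<alpha>)
      {\<omega>. \<forall>k<m. \<forall>i\<in>S. snd (\<omega> (p, q, k)) i \<longrightarrow> fst (\<omega> (p, q, k)) i \<notin> R}
      = (\<Prod>e\<in>homotopy_edges m N. if e \<in> K then measure_pmf.prob (edge_pmf d \<alpha>) X else 1)"
    by (auto simp: outcome_pmf_def measure_Pi_pmf_Pi finite_homotopy_edges intro!: prod.cong)
  also have "\<dots> = measure_pmf.prob (edge_pmf d \<alpha>) X ^ m"
    using K \<open>card K = m\<close> by (simp add: prod.If_cases finite_homotopy_edges Int_absorb1)
  also have "\<dots> \<le> exp (- \<alpha> * real (card S) * real (card R) / real d) ^ m"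
    unfolding X_def using assms by (intro power_mono prob_edge_avoids_le) auto
  also have "\<dots> = exp (- (\<alpha> * real m) * (real (card S) * real (card R) / real d))"
    by (simp add: exp_of_nat_mult[symmetric] mult_ac)
  finally show ?thesis .
qed

section \<open>Union bound over pairs of blocked sets\<close>

lemma sum_Pow_power_card:
  fixes x :: "'a :: comm_semiring_1"
  assumes "finite A"
  shows "(\<Sum>S\<in>Pow A. x ^ card S) = (1 + x) ^ card A"
    and "(\<Sum>S\<in>Pow A. x ^ card (A - S)) = (1 + x) ^ card A"
  \<comment> \<open>Expanding the product of \<open>x + 1\<close> over \<open>A\<close> gives a sum
    over subsets; exchanging the summands replaces each subset by its complement.\<close>
  using prod_add[OF assms, of "\<lambda>_. x" "\<lambda>_. 1"] prod_add[OF assms, of "\<lambda>_. 1" "\<lambda>_. x"]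
  by (simp_all add: add.commute)

text \<open>The hypotheses give \<open>r \<ge> d / 2\<close>, hence
  \<open>a * r / d \<ge> a / 2\<close>, and also \<open>d - r \<le> a\<close>. The new exponent is
  additive, so the bound factorises when summed over pairs of sets.\<close>

lemma exp_product_le:
  fixes a r d c :: real
  assumes "0 \<le> a" "0 < d" "a \<le> r" "d \<le> a + r" "0 \<le> c"
  shows "exp (- c * (a * r / d)) \<le> exp (- c / 4 * (a + (d - r)))"
proof -
  have "a * d \<le> a * (2 * r)" using assms by (intro mult_left_mono) auto
  then have "a / 2 \<le> a * r / d" using assms by (simp add: field_simps)
  moreover have "(a + (d - r)) / 4 \<le> a / 2" using assms by simp
  ultimately have "c * ((a + (d - r)) / 4) \<le> c * (a * r / d)"
    using assms by (intro mult_left_mono) linarith+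
  then show ?thesis by (simp only: exp_le_cancel_iff)
qed

text \<open>The smaller set of a pair plays the role of \<open>a\<close> and the complement of the
  larger one that of \<open>d - r\<close>; the two possible orders cause the factor 2. Excluding the
  empty set yields \<open>y - 1\<close>, the factor that becomes small.\<close>

lemma sum_blocked_le:
  fixes c :: real
  assumes "0 < d" "0 \<le> c"
  defines "I \<equiv> {(S, R). S \<subseteq> {..<d} \<and> R \<subseteq> {..<d} \<and> S \<noteq> {} \<and> R \<noteq> {} \<and> d \<le> card S + card R}"
    and "y \<equiv> (1 + exp (- c / 4)) ^ d"
  shows "(\<Sum>(S, R)\<in>I. exp (- c * (real (card S) * real (card R) / real d))) \<le> 2 * ((y - 1) * y)"
proof -
  define A where "A = {..<d}"
  define x where "x = exp (- c / 4)"
  define h where "h S R = x ^ card S * x ^ card (A - R)" for S R :: "nat set"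
  \<comment> \<open>The size condition is dropped, but the first set stays nonempty. For the swapped
    pairs this relies on \<open>R \<noteq> {}\<close>.\<close>
  define J where "J = (Pow A - {{}}) \<times> Pow A"
  have finJ: "finite J" by (simp add: J_def A_def)
  have y: "y = (1 + x) ^ card A" by (simp add: y_def x_def A_def)
  have "(\<Sum>S\<in>Pow A - {{}}. x ^ card S) = y - 1"
    by (subst sum_diff) (auto simp: A_def sum_Pow_power_card y)
  moreover have "(\<Sum>R\<in>Pow A. x ^ card (A - R)) = y"
    by (simp add: A_def sum_Pow_power_card y)
  ultimately have J: "(\<Sum>(S, R)\<in>J. h S R) = (y - 1) * y"
    by (simp add: J_def h_def sum.cartesian_product[symmetric] flip: sum_product)
  have I: "I \<subseteq> J" "I \<subseteq> prod.swap ` J"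
    by (auto simp: I_def J_def A_def image_iff)
  have hpos: "0 \<le> h S R" for S R by (simp add: h_def x_def)
  have h: "exp (- c / 4 * (real (card S) + (real d - real (card R)))) = h S R" if "R \<subseteq> A" for S R
  proof -
    have "card R \<le> d" using card_mono[OF _ that] by (simp add: A_def)
    moreover have "card (A - R) = d - card R"
      using that by (simp add: A_def card_Diff_subset finite_subset)
    ultimately have eq: "real d - real (card R) = real (card (A - R))" by simp
    have "h S R = exp (real (card S) * (- c / 4) + real (card (A - R)) * (- c / 4))"
      by (simp only: h_def x_def exp_add exp_of_nat_mult)
    then show ?thesis
      unfolding eq by (simp only: distrib_left mult.commute)
  qed
  have le: "exp (- c * (real (card S) * real (card R) / real d)) \<le> h S R"
    if "card S \<le> card R" "d \<le> card S + card R" "R \<subseteq> A" for S R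
  proof -
    have "exp (- c * (real (card S) * real (card R) / real d))
        \<le> exp (- c / 4 * (real (card S) + (real d - real (card R))))"
      using that assms(1,2) by (intro exp_product_le) (auto simp flip: of_nat_add)
    also have "\<dots> = h S R" using that(3) by (rule h)
    finally show ?thesis .
  qed
  have "exp (- c * (real (card S) * real (card R) / real d)) \<le> h S R + h R S" if "(S, R) \<in> I" for S R
  proof (cases "card S \<le> card R")
    case True
    then show ?thesis
      using le[of S R] hpos[of R S] that by (simp add: I_def A_def)
  next
    case False
    then show ?thesis
      using le[of R S] hpos[of S R] that by (simp add: I_def A_def add.commute mult.commute)
  qed
  then have "(\<Sum>(S, R)\<in>I. exp (- c * (real (card S) * real (card R) / real d)))
      \<le> (\<Sum>(S, R)\<in>I. h S R) + (\<Sum>(S, R)\<in>I. h R S)"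
    by (subst sum.distrib[symmetric]) (auto intro!: sum_mono)
  moreover have "(\<Sum>(S, R)\<in>I. h S R) \<le> (\<Sum>(S, R)\<in>J. h S R)"
    using hpos by (intro sum_mono2 finJ I) auto
  moreover have "(\<Sum>(S, R)\<in>I. h R S) \<le> (\<Sum>(S, R)\<in>prod.swap ` J. h R S)"
    using hpos by (intro sum_mono2 finite_imageI finJ I) auto
  moreover have "(\<Sum>(S, R)\<in>prod.swap ` J. h R S) = (\<Sum>(S, R)\<in>J. h S R)"
    by (subst sum.reindex) (auto simp: split_beta)
  ultimately show ?thesis using J by simp
qed

lemma prob_finds_all_solutions_ge:
  fixes \<alpha> :: real and m N d :: nat
  assumes "2 \<le> N" "0 < d" "0 \<le> \<alpha>" "\<alpha> \<le> 1"
  defines "y \<equiv> (1 + exp (- (\<alpha> * real m) / 4)) ^ d"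
  shows "1 - 2 * ((y - 1) * y) \<le> measure_pmf.prob (model_pmf m N d \<alpha>) (finds_all_solutions m N d)"
proof -
  define I where "I = {(S, R). S \<subseteq> {..<d} \<and> R \<subseteq> {..<d} \<and> S \<noteq> {} \<and> R \<noteq> {} \<and> d \<le> card S + card R}"
  have finI: "finite I"
    by (rule finite_subset[of _ "Pow {..<d} \<times> Pow {..<d}"]) (auto simp: I_def)
  have ne: "solutions N d \<noteq> {}" "finite (solutions N d)"
    using assms by (auto simp: solutions_def lessThan_empty_iff)
  have "measure_pmf.prob (model_pmf m N d \<alpha>) (- finds_all_solutions m N d) \<le> 2 * ((y - 1) * y)"
    unfolding model_pmf_def
  proof (rule prob_pair_pmf_le)
    fix s assume "s \<in> set_pmf (pmf_of_set (solutions N d))"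
    then have s: "s \<in> solutions N d" using ne by simp
    \<comment> \<open>The two nodes are 0 and the start node, or 0 and 1 if the start node is
      0.\<close>
    define q where "q = max 1 (fst s)"
    have q: "0 < q" "q < N" "fst s \<in> {0, q}"
      using s assms(1) by (auto simp: q_def solutions_def)
    define blocked where "blocked SR = {\<omega> :: outcome. \<forall>k<m. \<forall>i\<in>fst SR.
        snd (\<omega> (0, q, k)) i \<longrightarrow> fst (\<omega> (0, q, k)) i \<notin> snd SR}" for SR
    have "measure_pmf.prob (outcome_pmf m N d \<alpha>) {\<omega>. (s, \<omega>) \<in> - finds_all_solutions m N d}
        \<le> measure_pmf.prob (outcome_pmf m N d \<alpha>) (\<Union>SR\<in>I. blocked SR)"
    proof (rule prob_mono_pmf)
      fix \<omega> assume \<omega>: "\<omega> \<in> set_pmf (outcome_pmf m N d \<alpha>)"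
        and fail: "\<omega> \<in> {\<omega>. (s, \<omega>) \<in> - finds_all_solutions m N d}"
      have perm: "fst (\<omega> (0, q, k)) permutes {..<d}" if "k < m" for k
      proof -
        obtain \<pi> where \<pi>: "\<pi> \<in> set_pmf (Pi_pmf (homotopy_edges m N) id (\<lambda>_. pmf_of_set {\<pi>. \<pi> permutes {..<d}}))"
            "\<omega> \<in> set_pmf (successes_pmf m N d \<alpha> \<pi>)"
          using \<omega> by (auto simp: outcome_pmf_conv_bind)
        then show ?thesis
          using fst_successes_pmf[OF \<pi>(2)] set_Pi_pmf_permutations[OF \<pi>(1)] by simp
      qed
      from fail have "(s, \<omega>) \<notin> finds_all_solutions m N d" by simp
      from not_finds_all_solutions_blocked[OF q(1,2) s q(3) perm this]
      show "\<omega> \<in> (\<Union>SR\<in>I. blocked SR)"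
        by (force simp: I_def blocked_def)
    qed
    also have "\<dots> \<le> (\<Sum>SR\<in>I. exp (- (\<alpha> * real m) * (real (card (fst SR)) * real (card (snd SR)) / real d)))"
    proof (rule prob_Un_pmf_le[OF finI])
      fix SR assume "SR \<in> I"
      then show "measure_pmf.prob (outcome_pmf m N d \<alpha>) (blocked SR)
          \<le> exp (- (\<alpha> * real m) * (real (card (fst SR)) * real (card (snd SR)) / real d))"
        unfolding blocked_def using assms q by (intro prob_blocked_le) (auto simp: I_def)
    qed
    also have "\<dots> \<le> 2 * ((y - 1) * y)"
      using sum_blocked_le[of d "\<alpha> * real m"] assms unfolding I_def y_def by (simp add: split_beta)
    finally show "measure_pmf.prob (outcome_pmf m N d \<alpha>) {\<omega>. (s, \<omega>) \<in> - finds_all_solutions m N d}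
        \<le> 2 * ((y - 1) * y)" .
  qed
  then show ?thesis
    using measure_pmf.prob_compl[of "finds_all_solutions m N d" "model_pmf m N d \<alpha>"]
    by (simp add: Compl_eq_Diff_UNIV)
qed

section \<open>Passage to the limit in both regimes\<close>

theorem proposition4:
  fixes N m :: "nat \<Rightarrow> nat" and \<alpha> :: "nat \<Rightarrow> real"
  assumes "\<And>d. d \<ge> 1 \<Longrightarrow> N d \<ge> 2"
    and "\<And>d. d \<ge> 1 \<Longrightarrow> m d \<ge> 1"
    and "\<And>d. d \<ge> 1 \<Longrightarrow> 0 \<le> \<alpha> d \<and> \<alpha> d \<le> 1"
  shows "(\<alpha> \<in> o(\<lambda>d. 1 / (real (N d) * real (m d))) \<and> (\<lambda>d. real (N d)) \<in> o(\<lambda>d. exp (real d)) \<longrightarrow>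
           (\<lambda>d. measure_pmf.prob (model_pmf (m d) (N d) d (\<alpha> d))
                  (finds_all_solutions (m d) (N d) d)) \<longlonglongrightarrow> 0) \<and>
         (\<alpha> \<in> \<omega>(\<lambda>d. ln (real d) / real (m d)) \<and> (\<lambda>d. real (N d)) \<in> O(\<lambda>d. ln (real d)) \<longrightarrow>
           (\<lambda>d. measure_pmf.prob (model_pmf (m d) (N d) d (\<alpha> d))
                  (finds_all_solutions (m d) (N d) d)) \<longlonglongrightarrow> 1)"
proof -
  define p where "p d = measure_pmf.prob (model_pmf (m d) (N d) d (\<alpha> d)) (finds_all_solutions (m d) (N d) d)" for d
  have "p \<longlonglongrightarrow> 0" if "\<alpha> \<in> o(\<lambda>d. 1 / (real (N d) * real (m d)))"
  proof -
    \<comment> \<open>With the constant \<open>1 / 2\<close> the geometric series is at most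
      2.\<close>
    from that have "eventually (\<lambda>d. norm (\<alpha> d) \<le> 1 / 2 * norm (1 / (real (N d) * real (m d)))) sequentially"
      by (rule landau_o.smallD) simp
    then have bound: "eventually (\<lambda>d. p d \<le> 2 / real d) sequentially"
      using eventually_gt_at_top[of 0]
    proof eventually_elim
      case (elim d)
      have \<alpha>: "0 \<le> \<alpha> d" "\<alpha> d \<le> 1" and pos: "0 < N d" "0 < m d"
        using assms[of d] elim(2) by auto
      then have half: "\<alpha> d * real (N d * m d) \<le> 1 / 2"
        using elim(1) by (simp add: field_simps)
      have "p d \<le> 1 / (1 - \<alpha> d * real (N d * m d)) / real d"
        unfolding p_def using \<alpha> elim(2) half by (intro prob_finds_all_solutions_le) auto
      also have "\<dots> \<le> 2 / real d"
        using half by (intro divide_right_mono) (auto simp: pos_divide_le_eq)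
      finally show ?case .
    qed
    show "p \<longlonglongrightarrow> 0"
      by (rule tendsto_sandwich[OF _ bound tendsto_const]) (simp add: p_def, real_asymp)
  qed
  moreover have "p \<longlonglongrightarrow> 1" if "\<alpha> \<in> \<omega>(\<lambda>d. ln (real d) / real (m d))"
  proof -
    \<comment> \<open>The constant 8, divided by the 4 in the exponent of \<open>x\<close>, gives
      \<open>x \<le> 1 / d^2\<close>, so that \<open>(1 + x) ^ d \<le> exp (1 / d)\<close> tends to
      1.\<close>
    from that have "eventually (\<lambda>d. norm (\<alpha> d) \<ge> 8 * norm (ln (real d) / real (m d))) sequentially"
      by (rule landau_omega.smallD) simp
    then have bound: "eventually (\<lambda>d. 1 - 2 * ((exp (1 / real d) - 1) * exp (1 / real d)) \<le> p d) sequentially"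
      using eventually_gt_at_top[of 0]
    proof eventually_elim
      case (elim d)
      have \<alpha>: "0 \<le> \<alpha> d" "\<alpha> d \<le> 1" and pos: "2 \<le> N d" "0 < m d"
        using assms[of d] elim(2) by auto
      define x where "x = exp (- (\<alpha> d * real (m d)) / 4)"
      have "8 * ln (real d) \<le> \<alpha> d * real (m d)"
        using elim \<alpha> pos by (simp add: field_simps)
      then have "x \<le> exp (- (2 * ln (real d)))" by (simp add: x_def)
      also have "\<dots> = 1 / real d ^ 2"
        using elim(2) by (simp add: exp_minus exp_double inverse_eq_divide)
      finally have "real d * x \<le> 1 / real d"
        using elim(2) by (simp add: field_simps power2_eq_square)
      moreover have "(1 + x) ^ d \<le> exp (real d * x)"
        using exp_ge_add_one_self[of x] by (subst exp_of_nat_mult) (auto intro!: power_mono simp: x_def add_nonneg_nonneg)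
      ultimately have upper: "(1 + x) ^ d \<le> exp (1 / real d)"
        by (meson exp_le_cancel_iff order_trans)
      have "1 \<le> (1 + x) ^ d" by (simp add: x_def one_le_power)
      then have "((1 + x) ^ d - 1) * (1 + x) ^ d \<le> (exp (1 / real d) - 1) * exp (1 / real d)"
        using upper by (intro mult_mono) auto
      then show ?case
        using prob_finds_all_solutions_ge[of "N d" d "\<alpha> d" "m d"] \<alpha> pos elim(2) by (simp add: x_def p_def)
    qed
    show "p \<longlonglongrightarrow> 1"
      by (rule tendsto_sandwich[OF bound _ _ tendsto_const]) (simp add: p_def, real_asymp)
  qed
  ultimately show ?thesis by (simp add: p_def[abs_def])
qed

end
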